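(* Let $\alpha>\beta>1$, let $f$ be an odd, real-analytic, $2\pi$-periodic function with Fourier expansion $f(t)=\sum_{\nu\ge 1}\hat f_\nu\sin\nu t$, where $\hat f_\nu\in\mathbb{R}$ and $|\hat f_\nu|\le \Phi e^{-\xi\nu}$ for some constants $\Phi,\xi>0$, and let $\rho=p/q$ with $p,q$ relatively prime positive integers. Let $A$, $\Omega_0$, $\mathfrak{D}_1$, $K_1,K_2$ be as defined in the context, and let $\hat K_{i n}$ ($n\in\mathbb{Z}$, $i=1,2$) be the Fourier coefficients of the $2\pi\rho$-periodic function $K_i$, i.e. $K_i(\tau)=\sum_{n\in\mathbb{Z}}\hat K_{in}e^{\mathrm{i}n\tau/\rho}$. Then for every $\tau_0\in\mathbb{R}$ $$\mathfrak{D}_1(\tau_0)=-\frac{1}{A\rho^2\Omega_0^2}\sum_{\substack{\nu\ge1\\ \nu\rho\ \text{an even integer}}}\hat f_\nu\Big(\overline K_{1(\nu\rho)}\cos\nu\tau_0+\overline K_{2(\nu\rho)}\sin\nu\tau_0\Big),$$ where, for $n\in\mathbb{Z}$, $$\overline K_{1n}=\sum_{\sigma=\pm1}\Big[\frac{\sigma}{2\mathrm{i}}\big(\hat K_{1(-\sigma n)}+\hat K_{2(-\sigma n)}\big)+\frac{n\Omega_0}{2}\hat K_{2(-\sigma n)}\Big],$$ $$\overline K_{2n}=\sum_{\sigma=\pm1}\Big[\frac12\big(\hat K_{1(-\sigma n)}+\hat K_{2(-\sigma n)}\big)-n\Omega_0\frac{\sigma}{2\mathrm{i}}\hat K_{2(-\sigma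 n)}\Big].$$
   Context: Put $h(u)=1-\beta+3\beta u^2$ and $k(u)=u(\alpha-\beta+\beta u^2)$. The perturbed equation under study is $u''+u'h(u)+k(u)+\mu\Psi(u,u',t)=0$ with $\Psi(u,u',t)=u'(3u^2-1)f(\omega t)+u(u^2-1)(f(\omega t)+\omega f'(\omega t))$. For $\alpha>\beta>1$ the unperturbed Liénard equation $u''+u'h(u)+k(u)=0$ has a unique, globally attracting limit cycle encircling the origin; let $T_0$ be its period and $\Omega_0=2\pi/T_0$. The limit cycle has the symmetry that shifting time by half a period changes the sign of the solution. Fix $\rho=p/q>0$ with $p,q$ relatively prime. In the rescaled time $\tau=\rho\Omega_0 t$ the unperturbed equation is $\ddot u=G(u,\dot u)$ with $G(u,v)=-\frac{v\,h(u)}{\rho\Omega_0}-\frac{k(u)}{\rho^2\Omega_0^2}$ (dots denote $d/d\tau$). Let $u_0(\tau)$ be the $2\pi\rho$-periodic solution describing the limit cycle, with time origin fixed by $\dot u_0(0)=0$, $u_0(0)=U_0>0$, and let $v_0=\dot u_0$. Let $F(\tau)=\frac{1}{\rho\Omega_0}\int_0^\tau h(u_0(\tau'))\,d\tau'$, $f_0=F(2\pi\rho)/(2\pi\rho)$ and $\tilde F(\tau)=F(\tau)-f_0\tau$, which is $2\pi\rho$-periodic. It is known that $f_0>0$. Let $w_{11}$ be the solution of the linearised equation $\ddot w=\partial_uG(u_0,v_0)\,w+\partial_vG(u_0,v_0)\,\dot w$ with $w_{11}(0)=1$, $\dot w_{11}(0)=0$. It is known that $w_{11}(\tau)=a(\tau)+e^{-f_0\tau}b(\tau)$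 with $a,b$ both $2\pi\rho$-periodic and $a$ a constant multiple of $\dot u_0$; this determines $b$. Define $$A=\frac{1}{2\pi\rho}\int_0^{2\pi\rho}e^{\tilde F(\tau)}b(\tau)\Big[\dot u_0(\tau)h(u_0(\tau))+\frac{2}{\rho\Omega_0}k(u_0(\tau))\Big]d\tau ,$$ which is known to equal $U_0(\alpha-\beta+\beta U_0^2)/(\rho\Omega_0)$ (in particular $A\ne0$), and $$K_1(\tau)=e^{\tilde F(\tau)}b(\tau)\,\rho\Omega_0\,v_0(\tau)(3u_0^2(\tau)-1),\qquad K_2(\tau)=e^{\tilde F(\tau)}b(\tau)\,u_0(\tau)(u_0^2(\tau)-1).$$ For $\nu\ge1$ and $i=1,2$ set $$B_{i1\nu}=\frac{1}{2\pi p}\int_0^{2\pi p}\frac{K_i(\tau)}{\rho^2\Omega_0^2}\sin\nu\tau\,d\tau,\qquad B_{i2\nu}=\frac{1}{2\pi p}\int_0^{2\pi p}\frac{K_i(\tau)}{\rho^2\Omega_0^2}\cos\nu\tau\,d\tau,$$ $B_{31\nu}=\nu\rho\Omega_0B_{22\nu}$, $B_{32\nu}=-\nu\rho\Omega_0B_{21\nu}$, and $D_{j\nu}=-(B_{1j\nu}+B_{2j\nu}+B_{3j\nu})$ for $j=1,2$. Finally $$\mathfrak{D}_1(\tau_0)=\frac1A\sum_{\nu=1}^\infty\hat f_\nu\big(D_{1\nu}\cos\nu\tau_0+D_{2\nu}\sin\nu\tau_0\big).$$ *)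

theory Defs
  imports "HOL-Analysis.Analysis"
begin

definition lienard_h :: "real \<Rightarrow> real \<Rightarrow> real" where
  "lienard_h \<beta> u = 1 - \<beta> + 3 * \<beta> * u\<^sup>2"

definition lienard_k :: "real \<Rightarrow> real \<Rightarrow> real \<Rightarrow> real" where
  "lienard_k \<alpha> \<beta> u = u * (\<alpha> - \<beta> + \<beta> * u\<^sup>2)"

text \<open>Solutions of \<open>u'' + u' h(u) + k(u) = 0\<close> on a time set \<open>S\<close>, as a pair of position \<open>x\<close> and
  velocity \<open>y\<close>.\<close>

definition lienard_solution ::
    "real \<Rightarrow> real \<Rightarrow> real set \<Rightarrow> (real \<Rightarrow> real) \<Rightarrow> (real \<Rightarrow> real) \<Rightarrow> bool" where
  "lienard_solution \<alpha> \<beta> S x y \<longleftrightarrow>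
     (\<forall>t\<in>S. (x has_real_derivative y t) (at t within S) \<and>
            (y has_real_derivative (- y t * lienard_h \<beta> (x t) - lienard_k \<alpha> \<beta> (x t)))
              (at t within S))"

text \<open>The globally attracting limit cycle encircling the origin, with (least) period \<open>T\<close>. The
  origin is the only equilibrium, so attraction is required of every other forward solution; in
  particular every closed orbit coincides with the limit cycle.\<close>

definition lienard_limit_cycle ::
    "real \<Rightarrow> real \<Rightarrow> (real \<Rightarrow> real) \<Rightarrow> (real \<Rightarrow> real) \<Rightarrow> real \<Rightarrow> bool" where
  "lienard_limit_cycle \<alpha> \<beta> x y T \<longleftrightarrow>
     lienard_solution \<alpha> \<beta> UNIV x y \<and>
     T > 0 \<and> (\<forall>t. x (t + T) = x t) \<and>
     (\<forall>S. 0 < S \<and> S < T \<longrightarrow> \<not> (\<forall>t. x (t + S) = x t)) \<and>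
     (0, 0) \<in> inside (range (\<lambda>t. (x t, y t))) \<and>
     (\<forall>\<xi> \<eta>. lienard_solution \<alpha> \<beta> {0..} \<xi> \<eta> \<and> (\<xi> 0, \<eta> 0) \<noteq> (0, 0) \<longrightarrow>
        ((\<lambda>t. infdist (\<xi> t, \<eta> t) (range (\<lambda>t. (x t, y t)))) \<longlongrightarrow> 0) at_top)"

text \<open>Right-hand side of the unperturbed equation in the rescaled time \<open>\<tau> = \<rho> \<Omega> t\<close>.\<close>

definition rescaled_G ::
    "real \<Rightarrow> real \<Rightarrow> real \<Rightarrow> real \<Rightarrow> real \<Rightarrow> real \<Rightarrow> real" where
  "rescaled_G \<alpha> \<beta> \<rho> \<Omega> u v =
     - (v * lienard_h \<beta> u) / (\<rho> * \<Omega>) - lienard_k \<alpha> \<beta> u / (\<rho>\<^sup>2 * \<Omega>\<^sup>2)"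

text \<open>The interval integral is oriented, so that \<open>\<tau> < 0\<close> is covered.\<close>

definition F_int :: "real \<Rightarrow> real \<Rightarrow> real \<Rightarrow> (real \<Rightarrow> real) \<Rightarrow> real \<Rightarrow> real" where
  "F_int \<beta> \<rho> \<Omega> u0 \<tau> = 1 / (\<rho> * \<Omega>) * (LBINT s=ereal 0..ereal \<tau>. lienard_h \<beta> (u0 s))"

definition F_mean :: "real \<Rightarrow> real \<Rightarrow> real \<Rightarrow> (real \<Rightarrow> real) \<Rightarrow> real" where
  "F_mean \<beta> \<rho> \<Omega> u0 = F_int \<beta> \<rho> \<Omega> u0 (2 * pi * \<rho>) / (2 * pi * \<rho>)"

definition F_tilde :: "real \<Rightarrow> real \<Rightarrow> real \<Rightarrow> (real \<Rightarrow> real) \<Rightarrow> real \<Rightarrow> real" where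
  "F_tilde \<beta> \<rho> \<Omega> u0 \<tau> = F_int \<beta> \<rho> \<Omega> u0 \<tau> - F_mean \<beta> \<rho> \<Omega> u0 * \<tau>"

definition A_coeff :: "real \<Rightarrow> real \<Rightarrow> real \<Rightarrow> real \<Rightarrow>
    (real \<Rightarrow> real) \<Rightarrow> (real \<Rightarrow> real) \<Rightarrow> (real \<Rightarrow> real) \<Rightarrow> real" where
  "A_coeff \<alpha> \<beta> \<rho> \<Omega> u0 v0 b =
     1 / (2 * pi * \<rho>) *
     integral {0..2 * pi * \<rho>} (\<lambda>\<tau>. exp (F_tilde \<beta> \<rho> \<Omega> u0 \<tau>) * b \<tau> *
       (v0 \<tau> * lienard_h \<beta> (u0 \<tau>) + 2 / (\<rho> * \<Omega>) * lienard_k \<alpha> \<beta> (u0 \<tau>)))"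

definition kernel1 :: "real \<Rightarrow> real \<Rightarrow> real \<Rightarrow>
    (real \<Rightarrow> real) \<Rightarrow> (real \<Rightarrow> real) \<Rightarrow> (real \<Rightarrow> real) \<Rightarrow> real \<Rightarrow> real" where
  "kernel1 \<beta> \<rho> \<Omega> u0 v0 b \<tau> =
     exp (F_tilde \<beta> \<rho> \<Omega> u0 \<tau>) * b \<tau> * (\<rho> * \<Omega>) * v0 \<tau> * (3 * (u0 \<tau>)\<^sup>2 - 1)"

definition kernel2 :: "real \<Rightarrow> real \<Rightarrow> real \<Rightarrow>
    (real \<Rightarrow> real) \<Rightarrow> (real \<Rightarrow> real) \<Rightarrow> real \<Rightarrow> real" where
  "kernel2 \<beta> \<rho> \<Omega> u0 b \<tau> =
     exp (F_tilde \<beta> \<rho> \<Omega> u0 \<tau>) * b \<tau> * u0 \<tau> * ((u0 \<tau>)\<^sup>2 - 1)"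

text \<open>For \<open>K = K\<^sub>i\<close> these are \<open>B\<^bsub>i1\<nu>\<^esub>\<close> (sine) and \<open>B\<^bsub>i2\<nu>\<^esub>\<close> (cosine), \<open>i = 1, 2\<close>.\<close>

definition B_sin :: "nat \<Rightarrow> real \<Rightarrow> real \<Rightarrow> (real \<Rightarrow> real) \<Rightarrow> nat \<Rightarrow> real" where
  "B_sin p \<rho> \<Omega> K \<nu> =
     1 / (2 * pi * real p) *
     integral {0..2 * pi * real p} (\<lambda>\<tau>. K \<tau> / (\<rho>\<^sup>2 * \<Omega>\<^sup>2) * sin (real \<nu> * \<tau>))"

definition B_cos :: "nat \<Rightarrow> real \<Rightarrow> real \<Rightarrow> (real \<Rightarrow> real) \<Rightarrow> nat \<Rightarrow> real" where
  "B_cos p \<rho> \<Omega> K \<nu> =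
     1 / (2 * pi * real p) *
     integral {0..2 * pi * real p} (\<lambda>\<tau>. K \<tau> / (\<rho>\<^sup>2 * \<Omega>\<^sup>2) * cos (real \<nu> * \<tau>))"

definition B31 :: "nat \<Rightarrow> real \<Rightarrow> real \<Rightarrow> (real \<Rightarrow> real) \<Rightarrow> nat \<Rightarrow> real" where
  "B31 p \<rho> \<Omega> K2 \<nu> = real \<nu> * \<rho> * \<Omega> * B_cos p \<rho> \<Omega> K2 \<nu>"

definition B32 :: "nat \<Rightarrow> real \<Rightarrow> real \<Rightarrow> (real \<Rightarrow> real) \<Rightarrow> nat \<Rightarrow> real" where
  "B32 p \<rho> \<Omega> K2 \<nu> = - real \<nu> * \<rho> * \<Omega> * B_sin p \<rho> \<Omega> K2 \<nu>"

definition D1_coeff ::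
    "nat \<Rightarrow> real \<Rightarrow> real \<Rightarrow> (real \<Rightarrow> real) \<Rightarrow> (real \<Rightarrow> real) \<Rightarrow> nat \<Rightarrow> real" where
  "D1_coeff p \<rho> \<Omega> K1 K2 \<nu> =
     - (B_sin p \<rho> \<Omega> K1 \<nu> + B_sin p \<rho> \<Omega> K2 \<nu> + B31 p \<rho> \<Omega> K2 \<nu>)"

definition D2_coeff ::
    "nat \<Rightarrow> real \<Rightarrow> real \<Rightarrow> (real \<Rightarrow> real) \<Rightarrow> (real \<Rightarrow> real) \<Rightarrow> nat \<Rightarrow> real" where
  "D2_coeff p \<rho> \<Omega> K1 K2 \<nu> =
     - (B_cos p \<rho> \<Omega> K1 \<nu> + B_cos p \<rho> \<Omega> K2 \<nu> + B32 p \<rho> \<Omega> K2 \<nu>)"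

definition frakD1_term :: "nat \<Rightarrow> real \<Rightarrow> real \<Rightarrow> (real \<Rightarrow> real) \<Rightarrow> (real \<Rightarrow> real) \<Rightarrow>
    (nat \<Rightarrow> real) \<Rightarrow> real \<Rightarrow> nat \<Rightarrow> real" where
  "frakD1_term p \<rho> \<Omega> K1 K2 fhat \<tau>0 \<nu> =
     fhat \<nu> * (D1_coeff p \<rho> \<Omega> K1 K2 \<nu> * cos (real \<nu> * \<tau>0) +
               D2_coeff p \<rho> \<Omega> K1 K2 \<nu> * sin (real \<nu> * \<tau>0))"

definition frakD1 :: "nat \<Rightarrow> real \<Rightarrow> real \<Rightarrow> real \<Rightarrow> (real \<Rightarrow> real) \<Rightarrow> (real \<Rightarrow> real) \<Rightarrow>
    (nat \<Rightarrow> real) \<Rightarrow> real \<Rightarrow> real" where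
  "frakD1 p \<rho> \<Omega> A K1 K2 fhat \<tau>0 =
     1 / A * (\<Sum>m. frakD1_term p \<rho> \<Omega> K1 K2 fhat \<tau>0 (Suc m))"

text \<open>Fourier coefficients of a \<open>2\<pi>\<rho>\<close>-periodic function with respect to \<open>e\<^bsup>in\<tau>/\<rho>\<^esup>\<close>.\<close>

definition fourier_coeff :: "real \<Rightarrow> (real \<Rightarrow> real) \<Rightarrow> int \<Rightarrow> complex" where
  "fourier_coeff \<rho> K n =
     complex_of_real (1 / (2 * pi * \<rho>)) *
     integral {0..2 * pi * \<rho>}
       (\<lambda>\<tau>. complex_of_real (K \<tau>) * exp (- \<i> * complex_of_real (of_int n * \<tau> / \<rho>)))"

definition Kbar1 :: "real \<Rightarrow> (int \<Rightarrow> complex) \<Rightarrow> (int \<Rightarrow> complex) \<Rightarrow> int \<Rightarrow> complex" where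
  "Kbar1 \<Omega> Kh1 Kh2 n =
     (\<Sum>\<sigma>\<in>{1, -1::int}.
        of_int \<sigma> / (2 * \<i>) * (Kh1 (- \<sigma> * n) + Kh2 (- \<sigma> * n)) +
        of_int n * complex_of_real \<Omega> / 2 * Kh2 (- \<sigma> * n))"

definition Kbar2 :: "real \<Rightarrow> (int \<Rightarrow> complex) \<Rightarrow> (int \<Rightarrow> complex) \<Rightarrow> int \<Rightarrow> complex" where
  "Kbar2 \<Omega> Kh1 Kh2 n =
     (\<Sum>\<sigma>\<in>{1, -1::int}.
        1 / 2 * (Kh1 (- \<sigma> * n) + Kh2 (- \<sigma> * n)) -
        of_int n * complex_of_real \<Omega> * (of_int \<sigma> / (2 * \<i>)) * Kh2 (- \<sigma> * n))"

definition even_resonances :: "real \<Rightarrow> nat set" where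
  "even_resonances \<rho> = {\<nu>. \<nu> \<ge> 1 \<and> (\<exists>m::int. even m \<and> real \<nu> * \<rho> = of_int m)}"

text \<open>The index \<open>\<nu>\<rho>\<close> is only used where it is an integer, and is then equal to its floor.\<close>

definition resonant_term :: "real \<Rightarrow> real \<Rightarrow> (real \<Rightarrow> real) \<Rightarrow> (real \<Rightarrow> real) \<Rightarrow>
    (nat \<Rightarrow> real) \<Rightarrow> real \<Rightarrow> nat \<Rightarrow> complex" where
  "resonant_term \<rho> \<Omega> K1 K2 fhat \<tau>0 \<nu> =
     complex_of_real (fhat \<nu>) *
     (Kbar1 \<Omega> (fourier_coeff \<rho> K1) (fourier_coeff \<rho> K2) \<lfloor>real \<nu> * \<rho>\<rfloor>
        * complex_of_real (cos (real \<nu> * \<tau>0)) +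
      Kbar2 \<Omega> (fourier_coeff \<rho> K1) (fourier_coeff \<rho> K2) \<lfloor>real \<nu> * \<rho>\<rfloor>
        * complex_of_real (sin (real \<nu> * \<tau>0)))"

definition real_analytic :: "(real \<Rightarrow> real) \<Rightarrow> bool" where
  "real_analytic f \<longleftrightarrow>
     (\<forall>x. \<exists>r>0. \<exists>c :: nat \<Rightarrow> real. \<forall>y. \<bar>y - x\<bar> < r \<longrightarrow> (\<lambda>n. c n * (y - x) ^ n) sums f y)"

end

theory Submission
  imports Defs
begin

text \<open>Half a period of the limit cycle, \<open>\<pi>\<rho>\<close> in the rescaled time, changes the sign of \<open>u\<^sub>0\<close>, because
  the reflected cycle is attracted to the cycle and therefore lies on it. A Wronskian argument shows
  that \<open>b\<close> changes sign too, so both kernels are \<open>\<pi>\<rho>\<close>-periodic. The interval \<open>[0, 2\<pi>p]\<close>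
  consists of \<open>2q\<close> such half periods, over which the integral of \<open>K\<^sub>i(\<tau>) e\<^bsup>i\<nu>\<tau>\<^esup>\<close> is a geometric
  sum in the root of unity \<open>\<zeta> = e\<^bsup>i\<pi>\<nu>\<rho>\<^esup>\<close>. It vanishes unless \<open>\<zeta> = 1\<close>, which means that
  \<open>\<nu>\<rho>\<close> is an even integer.\<close>

subsection \<open>Linear second-order equations\<close>

text \<open>The Wronskian satisfies W' = P W, and \<open>F\<close> is an antiderivative of -P, so W
  times exp F has derivative zero.\<close>

lemma abel_identity:
  fixes P Q F y1 z1 y2 z2 :: "real \<Rightarrow> real"
  assumes "\<And>t. (y1 has_real_derivative z1 t) (at t)"
    and "\<And>t. (z1 has_real_derivative Q t * y1 t + P t * z1 t) (at t)"
    and "\<And>t. (y2 has_real_derivative z2 t) (at t)"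
    and "\<And>t. (z2 has_real_derivative Q t * y2 t + P t * z2 t) (at t)"
    and "\<And>t. (F has_real_derivative - P t) (at t)"
  shows "(y1 t * z2 t - z1 t * y2 t) * exp (F t) = (y1 0 * z2 0 - z1 0 * y2 0) * exp (F 0)"
proof -
  have "((\<lambda>t. (y1 t * z2 t - z1 t * y2 t) * exp (F t)) has_real_derivative 0) (at t)" for t
    by (rule derivative_eq_intros assms refl | simp add: algebra_simps)+
  then show ?thesis
    by (rule DERIV_isconst_all[rule_format])
qed

text \<open>By Abel's identity all three pairwise Wronskians evolve by the same factor, so the
  coefficients that Cramer's rule gives at time \<open>t\<close> do not depend on
  \<open>t\<close>.\<close>

lemma linear_ode_solution_combination:
  fixes P Q F y1 z1 y2 z2 y3 z3 :: "real \<Rightarrow> real"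
  assumes 1: "\<And>t. (y1 has_real_derivative z1 t) (at t)"
      "\<And>t. (z1 has_real_derivative Q t * y1 t + P t * z1 t) (at t)"
    and 2: "\<And>t. (y2 has_real_derivative z2 t) (at t)"
      "\<And>t. (z2 has_real_derivative Q t * y2 t + P t * z2 t) (at t)"
    and 3: "\<And>t. (y3 has_real_derivative z3 t) (at t)"
      "\<And>t. (z3 has_real_derivative Q t * y3 t + P t * z3 t) (at t)"
    and F: "\<And>t. (F has_real_derivative - P t) (at t)"
    and W: "y1 0 * z2 0 - z1 0 * y2 0 \<noteq> 0"
  shows "\<exists>m n. \<forall>t. y3 t = m * y1 t + n * y2 t"
proof -
  define W where "W = y1 0 * z2 0 - z1 0 * y2 0"
  define m where "m = (y3 0 * z2 0 - z3 0 * y2 0) / W"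
  define n where "n = (y1 0 * z3 0 - z1 0 * y3 0) / W"
  have "y3 t = m * y1 t + n * y2 t" for t
  proof -
    define e where "e = exp (F t) / exp (F 0)"
    have e: "e > 0" by (simp add: e_def)
    have ratio: "(r * exp (F t) = s * exp (F 0)) \<longleftrightarrow> r * e = s" for r s
      by (auto simp: e_def field_simps)
    have 12: "(y1 t * z2 t - z1 t * y2 t) * e = W"
      using abel_identity[OF 1 2 F, of t] by (simp only: ratio W_def)
    have 32: "(y3 t * z2 t - z3 t * y2 t) * e = m * W"
      using abel_identity[OF 3 2 F, of t] W by (simp add: ratio m_def W_def)
    have 13: "(y1 t * z3 t - z1 t * y3 t) * e = n * W"
      using abel_identity[OF 1 3 F, of t] W by (simp add: ratio n_def W_def)
    \<comment> \<open>The linear relation between three vectors of the plane, with their pairwise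
      determinants as coefficients.\<close>
    have "W * y3 t = ((y3 t * z2 t - z3 t * y2 t) * e) * y1 t
        + ((y1 t * z3 t - z1 t * y3 t) * e) * y2 t"
      by (simp add: 12[symmetric] algebra_simps)
    also have "\<dots> = W * (m * y1 t + n * y2 t)"
      unfolding 32 13 by (simp add: algebra_simps)
    finally have "W * y3 t = W * (m * y1 t + n * y2 t)" .
    then show ?thesis
      using W by (simp add: W_def)
  qed
  then show ?thesis by blast
qed

text \<open>Serves to pass the period (\<open>c\<close> = 1) and the antiperiod (\<open>c\<close> =
  -1) on to velocities.\<close>

lemma derivative_multiplier:
  fixes f f' :: "real \<Rightarrow> real"
  assumes f: "\<And>t. (f has_real_derivative f' t) (at t)" and "\<And>t. f (t + L) = c * f t"
  shows "f' (t + L) = c * f' t"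
proof -
  have "((\<lambda>t. f (t + L)) has_real_derivative f' (t + L)) (at t)"
    using f[of "t + L"] by (simp only: DERIV_shift)
  moreover have "((\<lambda>t. f (t + L)) has_real_derivative c * f' t) (at t)"
    unfolding assms(2) by (rule DERIV_cmult[OF f])
  ultimately show ?thesis
    by (rule DERIV_unique)
qed

text \<open>Floquet argument: in the basis (\<open>v\<close>, \<open>z\<close>) the shift by
  \<open>L\<close> is triangular with diagonal entries -1 and \<open>n\<close>, while its square is
  diagonal with entries 1 and \<mu>^2. Hence n = \<mu> or n = -\<mu>; the sign of the determinant
  selects -\<mu>, and then the off-diagonal entry \<open>m\<close> must vanish.\<close>

lemma antiperiodic_second_solution:
  fixes P Q F v v' z z' :: "real \<Rightarrow> real"
  assumes v: "\<And>t. (v has_real_derivative v' t) (at t)"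
      "\<And>t. (v' has_real_derivative Q t * v t + P t * v' t) (at t)"
    and z: "\<And>t. (z has_real_derivative z' t) (at t)"
      "\<And>t. (z' has_real_derivative Q t * z t + P t * z' t) (at t)"
    and F: "\<And>t. (F has_real_derivative - P t) (at t)"
    and per: "\<And>t. P (t + L) = P t" "\<And>t. Q (t + L) = Q t"
    and v_anti: "\<And>t. v (t + L) = - v t"
    and z_mult: "\<And>t. z (t + 2 * L) = \<mu>\<^sup>2 * z t" and "\<mu> > 0"
    and init: "v 0 = 0" "v' 0 \<noteq> 0" "z 0 \<noteq> 0"
  shows "z (t + L) = - \<mu> * z t"
proof -
  have Sz: "((\<lambda>t. z (t + L)) has_real_derivative z' (t + L)) (at t)"
    "((\<lambda>t. z' (t + L)) has_real_derivative Q t * z (t + L) + P t * z' (t + L)) (at t)" for t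
    using z[of "t + L"] by (simp_all only: DERIV_shift per)
  have W: "v 0 * z' 0 - v' 0 * z 0 \<noteq> 0"
    using init by simp
  obtain m n where mn: "z (t + L) = m * v t + n * z t" for t
    using linear_ode_solution_combination[OF v z Sz F W] by blast
  have v'_anti: "v' (t + L) = - v' t" for t
    using derivative_multiplier[of v v' L "- 1", OF v(1)] v_anti by simp
  \<comment> \<open>The Wronskian keeps its sign, so the shift by \<open>L\<close>, which acts on the solution space with
    eigenvalue \<open>-1\<close> on \<open>v\<close>, has positive determinant \<open>-n\<close>.\<close>
  have "n < 0"
  proof -
    have "(v' 0 * z L) * exp (F L) = - (v' 0 * z 0) * exp (F 0)"
      using abel_identity[OF v z F, of L] v_anti[of 0] v'_anti[of 0] init by simp
    then have "(v' 0 * z 0) * (- n * exp (F L)) = (v' 0 * z 0) * exp (F 0)"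
      using mn[of 0] init by (simp add: algebra_simps)
    then have "- n * exp (F L) = exp (F 0)"
      using init by (simp only: mult_cancel_left mult_eq_0_iff) simp
    then have "- n = exp (F 0) / exp (F L)"
      by (simp add: field_simps)
    then show ?thesis
      by (metis exp_gt_zero divide_pos_pos neg_0_less_iff_less)
  qed
  \<comment> \<open>Two shifts by \<open>L\<close>, computed once through \<open>m\<close>,
    \<open>n\<close> and once through the multiplier of \<open>z\<close>.\<close>
  have sq: "\<mu>\<^sup>2 * z t = m * (n - 1) * v t + n\<^sup>2 * z t" for t
    using mn[of "t + L"] z_mult[of t] mn[of t] v_anti[of t]
    by (simp add: algebra_simps power2_eq_square)
  have "n\<^sup>2 = \<mu>\<^sup>2"
    using sq[of 0] init by simp
  then have n: "n = - \<mu>"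
    using \<open>n < 0\<close> \<open>\<mu> > 0\<close> by (simp add: power2_eq_iff)
  have "\<exists>t. v t \<noteq> 0"
  proof (rule ccontr)
    assume "\<not> ?thesis"
    then have "v = (\<lambda>t. 0)" by auto
    then have "(v has_real_derivative 0) (at 0)" by simp
    with v(1)[of 0] init show False
      using DERIV_unique by blast
  qed
  then obtain s where "v s \<noteq> 0" by auto
  \<comment> \<open>What remains of \<open>sq\<close> is m (n - 1) v s = 0, where n - 1 < 0.\<close>
  with sq[of s] \<open>n\<^sup>2 = \<mu>\<^sup>2\<close> \<open>n < 0\<close> have "m = 0" by simp
  with mn n show ?thesis by simp
qed

section \<open>Uniqueness for linear equations by an energy estimate\<close>

lemma gronwall_zero:
  fixes E E' :: "real \<Rightarrow> real"
  assumes deriv: "\<And>t. (E has_real_derivative E' t) (at t)"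
    and bound: "\<And>t. \<bar>t\<bar> \<le> R \<Longrightarrow> \<bar>E' t\<bar> \<le> C * E t"
    and "E 0 = 0" "E t \<ge> 0" "\<bar>t\<bar> \<le> R"
  shows "E t = 0"
proof (cases "t \<ge> 0")
  case True
  \<comment> \<open>The weight exp (-C t) turns the bound on E' into monotonicity; for negative
    times the weight is exp (C t).\<close>
  have "E t * exp (- C * t) \<le> E 0 * exp (- C * 0)"
  proof (rule DERIV_nonpos_imp_nonincreasing[OF True])
    fix s assume s: "0 \<le> s" "s \<le> t"
    have "((\<lambda>t. E t * exp (- C * t)) has_real_derivative (E' s - C * E s) * exp (- C * s)) (at s)"
      by (rule derivative_eq_intros deriv refl | simp add: algebra_simps)+
    moreover have "E' s - C * E s \<le> 0"
      using bound[of s] s \<open>\<bar>t\<bar> \<le> R\<close> by linarith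
    ultimately show "\<exists>d. ((\<lambda>t. E t * exp (- C * t)) has_real_derivative d) (at s) \<and> d \<le> 0"
      by (meson exp_ge_zero mult_nonpos_nonneg)
  qed
  then show ?thesis
    using assms by (simp add: mult_le_0_iff)
next
  case False
  have "E t * exp (C * t) \<le> E 0 * exp (C * 0)"
  proof (rule DERIV_nonneg_imp_nondecreasing[of t 0])
    show "t \<le> 0" using False by simp
  next
    fix s assume s: "t \<le> s" "s \<le> 0"
    have "((\<lambda>t. E t * exp (C * t)) has_real_derivative (E' s + C * E s) * exp (C * s)) (at s)"
      by (rule derivative_eq_intros deriv refl | simp add: algebra_simps)+
    moreover have "E' s + C * E s \<ge> 0"
      using bound[of s] s \<open>\<bar>t\<bar> \<le> R\<close> by linarith
    ultimately show "\<exists>d. ((\<lambda>t. E t * exp (C * t)) has_real_derivative d) (at s) \<and> d \<ge> 0"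
      by (meson exp_ge_zero mult_nonneg_nonneg)
  qed
  then show ?thesis
    using assms by (simp add: mult_le_0_iff)
qed

text \<open>The energy d^2 + e^2 satisfies a Gronwall bound on each compact interval, where
  \<open>P\<close> and \<open>Q\<close> are bounded. It will be applied to the difference of two
  solutions of the nonlinear equation.\<close>

lemma linear_ode_zero:
  fixes P Q d e :: "real \<Rightarrow> real"
  assumes d: "\<And>t. (d has_real_derivative e t) (at t)"
    and e: "\<And>t. (e has_real_derivative Q t * d t + P t * e t) (at t)"
    and cont: "continuous_on UNIV P" "continuous_on UNIV Q"
    and init: "d 0 = 0" "e 0 = 0"
  shows "d t = 0"
proof -
  define R where "R = \<bar>t\<bar>"
  have bounded: "\<exists>M. \<forall>s. \<bar>s\<bar> \<le> R \<longrightarrow> \<bar>g s\<bar> \<le> M" if "continuous_on UNIV g" for g :: "real \<Rightarrow> real"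
  proof -
    have "bounded (g ` {-R..R})"
      by (intro compact_imp_bounded compact_continuous_image continuous_on_subset[OF that]) auto
    then obtain M where "\<forall>s\<in>{-R..R}. \<bar>g s\<bar> \<le> M"
      unfolding bounded_iff by auto
    then show ?thesis
      by (intro exI[of _ M]) (auto simp: abs_le_iff)
  qed
  obtain MP where MP: "\<And>s. \<bar>s\<bar> \<le> R \<Longrightarrow> \<bar>P s\<bar> \<le> MP"
    using bounded[OF cont(1)] by auto
  obtain MQ where MQ: "\<And>s. \<bar>s\<bar> \<le> R \<Longrightarrow> \<bar>Q s\<bar> \<le> MQ"
    using bounded[OF cont(2)] by auto
  let ?E = "\<lambda>s. (d s)\<^sup>2 + (e s)\<^sup>2"
  let ?E' = "\<lambda>s. (1 + Q s) * (2 * (d s * e s)) + 2 * P s * (e s)\<^sup>2"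
  have "?E t = 0"
  \<comment> \<open>\<open>C\<close> combines 2 |d e| \<le> d^2 + e^2, weighted by 1 + MQ, with the
    damping term 2 P e^2.\<close>
  proof (rule gronwall_zero[where E = ?E and E' = ?E' and R = R and C = "1 + MQ + 2 * MP"])
    show "(?E has_real_derivative ?E' s) (at s)" for s
      by (rule derivative_eq_intros d e refl | simp add: algebra_simps power2_eq_square)+
    show "\<bar>?E' s\<bar> \<le> (1 + MQ + 2 * MP) * ?E s" if "\<bar>s\<bar> \<le> R" for s
    proof -
      have "\<bar>2 * (d s * e s)\<bar> \<le> ?E s"
        using sum_squares_bound[of "\<bar>d s\<bar>" "\<bar>e s\<bar>"] by (simp add: abs_mult)
      moreover have "\<bar>1 + Q s\<bar> \<le> 1 + MQ"
        using MQ[OF that] by linarith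
      ultimately have "\<bar>(1 + Q s) * (2 * (d s * e s))\<bar> \<le> (1 + MQ) * ?E s"
        unfolding abs_mult[of "1 + Q s"] by (intro mult_mono) auto
      moreover have "\<bar>2 * P s * (e s)\<^sup>2\<bar> \<le> 2 * MP * ?E s"
        unfolding abs_mult using MP[OF that] by (intro mult_mono) auto
      ultimately show ?thesis
        by (simp add: algebra_simps)
    qed
  qed (use init in \<open>auto simp: R_def\<close>)
  then show ?thesis by (simp add: sum_power2_eq_zero_iff)
qed

subsection \<open>Half-period symmetry of the limit cycle\<close>

lemma lienard_solution_unique:
  assumes 1: "lienard_solution \<alpha> \<beta> UNIV x1 y1" and 2: "lienard_solution \<alpha> \<beta> UNIV x2 y2"
    and init: "x1 0 = x2 0" "y1 0 = y2 0"
  shows "x1 t = x2 t"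
proof -
  have d1: "(x1 has_real_derivative y1 t) (at t)"
    "(y1 has_real_derivative (- y1 t * lienard_h \<beta> (x1 t) - lienard_k \<alpha> \<beta> (x1 t))) (at t)" for t
    using 1 by (auto simp: lienard_solution_def)
  have d2: "(x2 has_real_derivative y2 t) (at t)"
    "(y2 has_real_derivative (- y2 t * lienard_h \<beta> (x2 t) - lienard_k \<alpha> \<beta> (x2 t))) (at t)" for t
    using 2 by (auto simp: lienard_solution_def)
  have cont: "continuous_on UNIV x1" "continuous_on UNIV x2" "continuous_on UNIV y2"
    by (auto intro!: continuous_at_imp_continuous_on intro: DERIV_isCont d1(1) d2)
  \<comment> \<open>Since \<open>lienard_h\<close> and \<open>lienard_k\<close> are polynomials, x1
    - x2 factors out of their differences. The difference of the solutions thus obeys a linear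
    equation with continuous coefficients.\<close>
  define P where "P t = - lienard_h \<beta> (x1 t)" for t
  define Q where "Q t = - (3 * \<beta> * y2 t * (x1 t + x2 t) + (\<alpha> - \<beta>)
      + \<beta> * ((x1 t)\<^sup>2 + x1 t * x2 t + (x2 t)\<^sup>2))" for t
  have "x1 t - x2 t = 0"
  proof (rule linear_ode_zero[of "\<lambda>t. x1 t - x2 t" "\<lambda>t. y1 t - y2 t" Q P])
    show "((\<lambda>t. x1 t - x2 t) has_real_derivative y1 t - y2 t) (at t)" for t
      by (intro derivative_intros d1 d2)
    have "- y1 t * lienard_h \<beta> (x1 t) - lienard_k \<alpha> \<beta> (x1 t)
        - (- y2 t * lienard_h \<beta> (x2 t) - lienard_k \<alpha> \<beta> (x2 t))
        = Q t * (x1 t - x2 t) + P t * (y1 t - y2 t)" for t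
      by (simp add: P_def Q_def lienard_h_def lienard_k_def power2_eq_square algebra_simps)
    then show "((\<lambda>t. y1 t - y2 t) has_real_derivative
        Q t * (x1 t - x2 t) + P t * (y1 t - y2 t)) (at t)" for t
      using DERIV_diff[OF d1(2) d2(2)] by metis
    show "continuous_on UNIV P" "continuous_on UNIV Q"
      unfolding P_def Q_def lienard_h_def by (intro continuous_intros cont)+
  qed (use init in auto)
  then show ?thesis by simp
qed

lemma periodic_int:
  fixes g :: "real \<Rightarrow> 'a"
  assumes "\<And>t. g (t + T) = g t"
  shows "g (t + of_int k * T) = g t"
proof (induction k rule: int_induct[where k = 0])
  case (step1 i)
  then show ?case using assms[of "t + of_int i * T"] by (simp add: algebra_simps)
next
  case (step2 i)
  then show ?case using assms[of "t + of_int (i - 1) * T"] by (simp add: algebra_simps)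
qed simp

text \<open>\<open>lienard_h\<close> is even and \<open>lienard_k\<close> is odd, so the reflected
  cycle is a solution too. Attraction puts it on the cycle, whence x (t + s) = - x t for some
  \<open>s\<close>. Then 2 s is a period, so s is a multiple k T / 2 by minimality of
  \<open>T\<close>, and \<open>k\<close> must be odd.\<close>

lemma lienard_limit_cycle_half_period:
  assumes lc: "lienard_limit_cycle \<alpha> \<beta> x y T"
  shows "x (t + T / 2) = - x t"
proof -
  define C where "C = range (\<lambda>t. (x t, y t))"
  have sol: "lienard_solution \<alpha> \<beta> UNIV x y" and "T > 0" and per: "\<And>t. x (t + T) = x t"
    and least: "\<And>S. 0 < S \<Longrightarrow> S < T \<Longrightarrow> \<exists>t. x (t + S) \<noteq> x t"
    and inside: "(0, 0) \<in> inside C"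
    and attr: "\<And>\<xi> \<eta>. lienard_solution \<alpha> \<beta> {0..} \<xi> \<eta> \<Longrightarrow> (\<xi> 0, \<eta> 0) \<noteq> (0, 0) \<Longrightarrow>
        ((\<lambda>t. infdist (\<xi> t, \<eta> t) C) \<longlongrightarrow> 0) at_top"
    using lc unfolding lienard_limit_cycle_def C_def by blast+
  have d: "(x has_real_derivative y t) (at t)"
    "(y has_real_derivative (- y t * lienard_h \<beta> (x t) - lienard_k \<alpha> \<beta> (x t))) (at t)" for t
    using sol by (auto simp: lienard_solution_def)
  have cont: "continuous_on UNIV x" "continuous_on UNIV y"
    by (auto intro!: continuous_at_imp_continuous_on intro: DERIV_isCont d)
  have pery: "y (t + T) = y t" for t
    using derivative_multiplier[of x y T 1, OF d(1)] per by simp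
  \<comment> \<open>As the image of a compact interval, the orbit is closed, so distance zero will
    mean membership.\<close>
  have "C = (\<lambda>t. (x t, y t)) ` {0..T}"
  proof (intro equalityI subsetI)
    fix z assume "z \<in> C"
    then obtain t where z: "z = (x t, y t)" by (auto simp: C_def)
    define r where "r = t + of_int (- \<lfloor>t / T\<rfloor>) * T"
    have "r = T * frac (t / T)"
      using \<open>T > 0\<close> by (simp add: r_def frac_def field_simps)
    then have "r \<in> {0..T}"
      using \<open>T > 0\<close> frac_ge_0[of "t / T"] frac_lt_1[of "t / T"] by (simp add: mult_left_le)
    moreover have "z = (x r, y r)"
      unfolding z r_def using periodic_int[of x, OF per] periodic_int[of y, OF pery] by metis
    ultimately show "z \<in> (\<lambda>t. (x t, y t)) ` {0..T}" by blast
  qed (auto simp: C_def)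
  then have "closed C"
    by (auto intro!: compact_imp_closed compact_continuous_image continuous_intros
        continuous_on_subset[OF cont(1)] continuous_on_subset[OF cont(2)])
  have not0: "(x t, y t) \<noteq> (0, 0)" for t
    using inside inside_no_overlap[of C] by (metis C_def disjoint_iff rangeI)
  have sol_neg: "lienard_solution \<alpha> \<beta> UNIV (\<lambda>t. - x t) (\<lambda>t. - y t)"
    unfolding lienard_solution_def
  proof (intro ballI conjI)
    show "((\<lambda>t. - x t) has_real_derivative - y t) (at t)" for t
      by (intro derivative_intros d)
    show "((\<lambda>t. - y t) has_real_derivative
        - (- y t) * lienard_h \<beta> (- x t) - lienard_k \<alpha> \<beta> (- x t)) (at t)" for t
      using DERIV_minus[OF d(2)[of t]] by (simp add: lienard_h_def lienard_k_def algebra_simps)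
  qed
  then have "lienard_solution \<alpha> \<beta> {0..} (\<lambda>t. - x t) (\<lambda>t. - y t)"
    unfolding lienard_solution_def by (auto intro: has_field_derivative_at_within)
  then have "((\<lambda>t. infdist (- x t, - y t) C) \<longlongrightarrow> 0) at_top"
    using not0[of 0] by (intro attr) auto
  \<comment> \<open>Sampled at the multiples of \<open>T\<close>, the distance is constant; since it
    tends to 0, it is 0.\<close>
  moreover have "filterlim (\<lambda>n::nat. real n * T) at_top sequentially"
    using \<open>T > 0\<close> by (intro filterlim_at_top_mult_tendsto_pos[OF tendsto_const]
        filterlim_real_sequentially)
  ultimately have "(\<lambda>n::nat. infdist (- x (real n * T), - y (real n * T)) C) \<longlonglongrightarrow> 0"
    by (rule filterlim_compose)
  moreover have "x (real n * T) = x 0" "y (real n * T) = y 0" for n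
    using periodic_int[of x, OF per, of 0 "int n"] periodic_int[of y, OF pery, of 0 "int n"] by simp_all
  ultimately have "infdist (- x 0, - y 0) C = 0"
    by (simp add: LIMSEQ_const_iff)
  then have "(- x 0, - y 0) \<in> C"
    using in_closed_iff_infdist_zero[OF \<open>closed C\<close>] by (auto simp: C_def)
  then obtain s where s: "x s = - x 0" "y s = - y 0"
    by (auto simp: C_def)
  \<comment> \<open>The equation is autonomous, so time translates of solutions are
    solutions.\<close>
  have shifted: "lienard_solution \<alpha> \<beta> UNIV (\<lambda>t. x (t + s)) (\<lambda>t. y (t + s))"
    unfolding lienard_solution_def
    using d(1)[of "_ + s"] d(2)[of "_ + s"] by (simp only: DERIV_shift) blast
  then have anti: "x (t + s) = - x t" for t
    using lienard_solution_unique[OF shifted sol_neg] by (simp add: s)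
  define k where "k = \<lfloor>2 * s / T\<rfloor>"
  \<comment> \<open>The remainder of 2 s modulo \<open>T\<close> is again a period; being less than
    \<open>T\<close>, it must be 0.\<close>
  define r where "r = 2 * s - of_int k * T"
  have "r = T * frac (2 * s / T)"
    using \<open>T > 0\<close> by (simp add: r_def k_def frac_def field_simps)
  then have "0 \<le> r" "r < T"
    using \<open>T > 0\<close> frac_ge_0[of "2 * s / T"] frac_lt_1[of "2 * s / T"] by simp_all
  moreover have "x (t + r) = x t" for t
    using periodic_int[of x, OF per, of "t + 2 * s" "- k"] anti[of t] anti[of "t + s"]
    by (simp add: r_def algebra_simps)
  ultimately have "r = 0"
    using least[of r] by force
  then have s_eq: "s = of_int k * T / 2"
    by (simp add: r_def)
  have "odd k"
  proof
    assume "even k"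
    then obtain j where "k = 2 * j" by blast
    then have "x t = - x t" for t
      using anti[of t] periodic_int[of x, OF per, of t j] s_eq by simp
    then have "x = (\<lambda>t. 0)" by auto
    then have "y 0 = 0"
      using d(1)[of 0] DERIV_unique[of x] by (metis DERIV_const)
    with \<open>x = _\<close> not0[of 0] show False by simp
  qed
  then obtain j where "k = 2 * j + 1" by (rule oddE)
  then have shift: "t + s = t + T / 2 + of_int j * T"
    by (simp add: s_eq field_simps)
  show ?thesis
    using anti[of t] unfolding shift periodic_int[of x, OF per] .
qed

subsection \<open>Fourier integrals over several periods\<close>

text \<open>The integral over the j-th period is \<zeta>^j times the integral over the
  first.\<close>

lemma integral_quasiperiodic:
  fixes E :: "real \<Rightarrow> complex"
  assumes cont: "continuous_on UNIV E" and per: "\<And>t. E (t + T) = \<zeta> * E t" and "T \<ge> 0"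
  shows "integral {0..real n * T} E = (\<Sum>j<n. \<zeta> ^ j) * integral {0..T} E"
proof (induction n)
  case (Suc n)
  have shift: "E (t + real m * T) = \<zeta> ^ m * E t" for t m
  proof (induction m)
    case (Suc m)
    then show ?case
      using per[of "t + real m * T"] by (simp add: algebra_simps)
  qed simp
  have "integral {real n * T..real (Suc n) * T} E = integral {0..T} (E \<circ> (\<lambda>t. t + real n * T))"
    using integral_shift[of 0 "real n * T" T E] continuous_on_subset[OF cont]
    by (simp add: algebra_simps)
  also have "\<dots> = \<zeta> ^ n * integral {0..T} E"
    by (simp add: o_def shift)
  finally have "integral {real n * T..real (Suc n) * T} E = \<zeta> ^ n * integral {0..T} E" .
  moreover have "integral {0..real n * T} E + integral {real n * T..real (Suc n) * T} E
      = integral {0..real (Suc n) * T} E"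
    using assms by (intro Henstock_Kurzweil_Integration.integral_combine
        integrable_continuous_interval continuous_on_subset[OF cont]) (auto intro: mult_right_mono)
  ultimately show ?case
    using Suc.IH by (simp add: algebra_simps)
qed simp

lemma sum_powers_root_of_unity:
  fixes \<zeta> :: "'a :: field"
  assumes "\<zeta> ^ n = 1" "\<zeta> \<noteq> 1"
  shows "(\<Sum>j<n. \<zeta> ^ j) = 0"
  using assms by (simp add: geometric_sum)

text \<open>One complex integral in place of two real ones: its parts are the cosine and sine
  integrals behind \<open>B_cos\<close> and \<open>B_sin\<close>, and at negative frequencies it
  gives Fourier coefficients.\<close>

definition oscillation :: "(real \<Rightarrow> real) \<Rightarrow> real \<Rightarrow> real \<Rightarrow> complex" where
  "oscillation K \<omega> L = integral {0..L} (\<lambda>\<tau>. complex_of_real (K \<tau>) * cis (\<omega> * \<tau>))"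

lemma integrable_oscillation:
  assumes "continuous_on UNIV K"
  shows "(\<lambda>\<tau>. complex_of_real (K \<tau>) * cis (\<omega> * \<tau>)) integrable_on {a..b}"
  unfolding cis_conv_exp
  by (intro integrable_continuous_interval continuous_intros continuous_on_subset[OF assms]) auto

lemma Re_oscillation:
  assumes "continuous_on UNIV K"
  shows "Re (oscillation K \<omega> L) = integral {0..L} (\<lambda>\<tau>. K \<tau> * cos (\<omega> * \<tau>))"
  using integral_linear[OF integrable_oscillation[OF assms] bounded_linear_Re, of 0 L \<omega>]
  by (simp add: o_def oscillation_def)

lemma Im_oscillation:
  assumes "continuous_on UNIV K"
  shows "Im (oscillation K \<omega> L) = integral {0..L} (\<lambda>\<tau>. K \<tau> * sin (\<omega> * \<tau>))"
  using integral_linear[OF integrable_oscillation[OF assms] bounded_linear_Im, of 0 L \<omega>]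
  by (simp add: o_def oscillation_def)

lemma oscillation_minus: "oscillation K (- \<omega>) L = cnj (oscillation K \<omega> L)"
  unfolding oscillation_def by (simp add: integral_cnj cis_cnj)

text \<open>The bound is uniform in the frequency, as summability over \<nu> requires.\<close>

lemma norm_oscillation_le:
  assumes "continuous_on UNIV K"
  shows "norm (oscillation K \<omega> L) \<le> integral {0..L} (\<lambda>\<tau>. \<bar>K \<tau>\<bar>)"
  unfolding oscillation_def
  by (intro integral_norm_bound_integral integrable_oscillation assms
      integrable_continuous_interval continuous_intros continuous_on_subset[OF assms])
    (auto simp: norm_mult)

lemma oscillation_periods:
  assumes "continuous_on UNIV K" "\<And>t. K (t + L) = K t" "L \<ge> 0"
  shows "oscillation K \<omega> (real n * L) = (\<Sum>j<n. cis (\<omega> * L) ^ j) * oscillation K \<omega> L"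
  unfolding oscillation_def
proof (rule integral_quasiperiodic)
  show "continuous_on UNIV (\<lambda>\<tau>. complex_of_real (K \<tau>) * cis (\<omega> * \<tau>))"
    unfolding cis_conv_exp by (intro continuous_intros assms)
  show "complex_of_real (K (t + L)) * cis (\<omega> * (t + L))
      = cis (\<omega> * L) * (complex_of_real (K t) * cis (\<omega> * t))" for t
    by (simp add: assms distrib_left flip: cis_mult)
qed (rule assms)

text \<open>The phase \<nu>\<pi>\<rho> is a multiple of 2\<pi> just when \<nu>\<rho> is even. The
  parity condition arises because the period considered is \<pi>\<rho>, not 2\<pi>\<rho>.\<close>

lemma cis_half_period_eq_1_iff:
  assumes "\<nu> \<ge> 1"
  shows "cis (real \<nu> * (pi * \<rho>)) = 1 \<longleftrightarrow> \<nu> \<in> even_resonances \<rho>"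
proof -
  have "cis (real \<nu> * (pi * \<rho>)) = 1 \<longleftrightarrow> cos (real \<nu> * (pi * \<rho>)) = 1"
    by (metis cis.sel(1) cis_zero cos_one_sin_zero complex_eq_iff cos_zero one_complex.sel cis.sel(2))
  also have "\<dots> \<longleftrightarrow> (\<exists>j::int. real \<nu> * (pi * \<rho>) = real_of_int j * 2 * pi)"
    by (rule cos_one_2pi_int)
  also have "\<dots> \<longleftrightarrow> (\<exists>j::int. real \<nu> * \<rho> = real_of_int (2 * j))"
    by (rule ex_cong1) (auto simp: field_simps)
  also have "\<dots> \<longleftrightarrow> (\<exists>m::int. even m \<and> real \<nu> * \<rho> = of_int m)"
    by (metis dvd_triv_left evenE)
  finally show ?thesis
    using assms by (simp add: even_resonances_def)
qed

lemma oscillation_nonresonant: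
  assumes "continuous_on UNIV K" "\<And>t. K (t + pi * \<rho>) = K t"
    and "p > 0" "q > 0" "\<rho> = real p / real q" "\<nu> \<ge> 1" "\<nu> \<notin> even_resonances \<rho>"
  shows "oscillation K (real \<nu>) (2 * pi * real p) = 0"
proof -
  let ?\<zeta> = "cis (real \<nu> * (pi * \<rho>))"
  \<comment> \<open>As p = \<rho> q, the 2 q half periods accumulate the phase 2\<pi>\<nu>p, so
    \<zeta> is a root of unity of order dividing 2 q.\<close>
  have "real (2 * q) * (real \<nu> * (pi * \<rho>)) = 2 * pi * real (\<nu> * p)"
    using assms by simp
  then have "?\<zeta> ^ (2 * q) = cis (2 * pi * real (\<nu> * p))"
    by (simp only: Complex.DeMoivre)
  also have "\<dots> = 1"
    by (intro cis_multiple_2pi) (rule Ints_of_nat)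
  finally have "?\<zeta> ^ (2 * q) = 1" .
  moreover have "?\<zeta> \<noteq> 1"
    using cis_half_period_eq_1_iff[OF assms(6), of \<rho>] assms(7) by blast
  ultimately have "(\<Sum>j<2 * q. ?\<zeta> ^ j) = 0"
    by (rule sum_powers_root_of_unity)
  moreover have "2 * pi * real p = real (2 * q) * (pi * \<rho>)" "pi * \<rho> \<ge> 0"
    using assms by simp_all
  ultimately show ?thesis
    by (simp only: oscillation_periods[OF assms(1,2)] mult_zero_left)
qed

text \<open>At resonance every half period contributes equally, so the mean over 2 q half periods
  equals the mean over two.\<close>

lemma oscillation_resonant:
  assumes "continuous_on UNIV K" "\<And>t. K (t + pi * \<rho>) = K t"
    and "p > 0" "q > 0" "\<rho> = real p / real q" "\<nu> \<in> even_resonances \<rho>"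
  shows "oscillation K (real \<nu>) (2 * pi * real p) / (2 * pi * real p)
    = oscillation K (real \<nu>) (2 * pi * \<rho>) / (2 * pi * \<rho>)"
proof -
  have "\<nu> \<ge> 1"
    using assms by (simp add: even_resonances_def)
  then have "cis (real \<nu> * (pi * \<rho>)) = 1"
    using assms cis_half_period_eq_1_iff by blast
  then have per: "oscillation K (real \<nu>) (real n * (pi * \<rho>))
      = of_nat n * oscillation K (real \<nu>) (pi * \<rho>)" for n
    using oscillation_periods[of K "pi * \<rho>" "real \<nu>" n] assms by simp
  have "2 * pi * real p = real (2 * q) * (pi * \<rho>)" "2 * pi * \<rho> = real 2 * (pi * \<rho>)"
    using assms by simp_all
  then have multiples: "oscillation K (real \<nu>) (2 * pi * real p)
      = of_nat (2 * q) * oscillation K (real \<nu>) (pi * \<rho>)"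
    "oscillation K (real \<nu>) (2 * pi * \<rho>) = of_nat 2 * oscillation K (real \<nu>) (pi * \<rho>)"
    by (simp_all only: per)
  have "real p = \<rho> * real q"
    using assms by simp
  then have "complex_of_nat p = complex_of_real \<rho> * complex_of_nat q"
    by (metis of_real_mult of_real_of_nat_eq)
  moreover have "\<rho> \<noteq> 0"
    using assms by simp
  ultimately show ?thesis
    unfolding multiples using \<open>q > 0\<close> by (simp add: field_simps)
qed

section \<open>The coefficients of \<open>frakD1\<close> as Fourier coefficients\<close>

lemma B_sin_eq:
  assumes "continuous_on UNIV K"
  shows "B_sin p \<rho> \<Omega> K \<nu>
    = Im (oscillation K (real \<nu>) (2 * pi * real p) / (2 * pi * real p)) / (\<rho>\<^sup>2 * \<Omega>\<^sup>2)"
proof -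
  have "Im (z / (2 * pi * real p)) = Im z / (2 * pi * real p)" for z
    using Im_divide_of_real[of z "2 * pi * real p"] by simp
  then show ?thesis
    unfolding B_sin_def by (simp add: Im_oscillation[OF assms])
qed

lemma B_cos_eq:
  assumes "continuous_on UNIV K"
  shows "B_cos p \<rho> \<Omega> K \<nu>
    = Re (oscillation K (real \<nu>) (2 * pi * real p) / (2 * pi * real p)) / (\<rho>\<^sup>2 * \<Omega>\<^sup>2)"
proof -
  have "Re (z / (2 * pi * real p)) = Re z / (2 * pi * real p)" for z
    using Re_divide_of_real[of z "2 * pi * real p"] by simp
  then show ?thesis
    unfolding B_cos_def by (simp add: Re_oscillation[OF assms])
qed

lemma fourier_coeff_eq:
  "fourier_coeff \<rho> K n = oscillation K (- (of_int n / \<rho>)) (2 * pi * \<rho>) / (2 * pi * \<rho>)"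
  by (simp add: fourier_coeff_def oscillation_def cis_conv_exp)

lemma frakD1_term_eq_resonant_term:
  assumes cont: "continuous_on UNIV K1" "continuous_on UNIV K2"
    and per: "\<And>t. K1 (t + pi * \<rho>) = K1 t" "\<And>t. K2 (t + pi * \<rho>) = K2 t"
    and pq: "p > 0" "q > 0" "\<rho> = real p / real q" and "\<nu> \<ge> 1"
  shows "complex_of_real (frakD1_term p \<rho> \<Omega> K1 K2 fhat \<tau>0 \<nu>)
    = (if \<nu> \<in> even_resonances \<rho>
       then - 1 / complex_of_real (\<rho>\<^sup>2 * \<Omega>\<^sup>2) * resonant_term \<rho> \<Omega> K1 K2 fhat \<tau>0 \<nu> else 0)"
proof (cases "\<nu> \<in> even_resonances \<rho>")
  case False
  then show ?thesis
    using oscillation_nonresonant[OF cont(1) per(1) pq \<open>\<nu> \<ge> 1\<close>]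
      oscillation_nonresonant[OF cont(2) per(2) pq \<open>\<nu> \<ge> 1\<close>]
    by (simp add: frakD1_term_def D1_coeff_def D2_coeff_def B31_def B32_def
        B_sin_eq[OF cont(1)] B_sin_eq[OF cont(2)] B_cos_eq[OF cont(1)] B_cos_eq[OF cont(2)])
next
  case True
  define n where "n = \<lfloor>real \<nu> * \<rho>\<rfloor>"
  have "\<rho> > 0" using pq by simp
  have n: "real_of_int n = real \<nu> * \<rho>"
    using True by (auto simp: even_resonances_def n_def)
  then have \<nu>: "real_of_int n / \<rho> = real \<nu>"
    using \<open>\<rho> > 0\<close> by simp
  \<comment> \<open>Because \<nu> = n / \<rho>, the mean \<open>m K\<close> is the Fourier
    coefficient of index -n; as \<open>K\<close> is real, index n gives its conjugate.\<close>
  define m where "m K = oscillation K (real \<nu>) (2 * pi * \<rho>) / (2 * pi * \<rho>)" for K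
  have four: "fourier_coeff \<rho> K (- n) = m K" "fourier_coeff \<rho> K n = cnj (m K)" for K
    using \<nu> by (simp_all add: fourier_coeff_eq m_def oscillation_minus)
  have B: "B_sin p \<rho> \<Omega> K \<nu> = Im (m K) / (\<rho>\<^sup>2 * \<Omega>\<^sup>2)" "B_cos p \<rho> \<Omega> K \<nu> = Re (m K) / (\<rho>\<^sup>2 * \<Omega>\<^sup>2)"
    if "K = K1 \<or> K = K2" for K
    using that oscillation_resonant[OF _ _ pq True, of K] cont per
    by (auto simp: B_sin_eq B_cos_eq m_def)
  \<comment> \<open>The terms for \<sigma> = 1 and \<sigma> = -1 pair \<open>m K\<close> with its
    conjugate, which leaves real and imaginary parts.\<close>
  have Kbar1: "Kbar1 \<Omega> (fourier_coeff \<rho> K1) (fourier_coeff \<rho> K2) n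
      = complex_of_real (Im (m K1) + Im (m K2) + real_of_int n * \<Omega> * Re (m K2))"
    by (simp add: Kbar1_def four complex_eq_iff field_simps)
  have Kbar2: "Kbar2 \<Omega> (fourier_coeff \<rho> K1) (fourier_coeff \<rho> K2) n
      = complex_of_real (Re (m K1) + Re (m K2) - real_of_int n * \<Omega> * Im (m K2))"
    by (simp add: Kbar2_def four complex_eq_iff field_simps)
  have "resonant_term \<rho> \<Omega> K1 K2 fhat \<tau>0 \<nu> = complex_of_real (fhat \<nu> *
      ((Im (m K1) + Im (m K2) + real_of_int n * \<Omega> * Re (m K2)) * cos (real \<nu> * \<tau>0)
       + (Re (m K1) + Re (m K2) - real_of_int n * \<Omega> * Im (m K2)) * sin (real \<nu> * \<tau>0)))"
    unfolding resonant_term_def n_def[symmetric] Kbar1 Kbar2 by simp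
  moreover have "frakD1_term p \<rho> \<Omega> K1 K2 fhat \<tau>0 \<nu> = - 1 / (\<rho>\<^sup>2 * \<Omega>\<^sup>2) * (fhat \<nu> *
      ((Im (m K1) + Im (m K2) + real_of_int n * \<Omega> * Re (m K2)) * cos (real \<nu> * \<tau>0)
       + (Re (m K1) + Re (m K2) - real_of_int n * \<Omega> * Im (m K2)) * sin (real \<nu> * \<tau>0)))"
    by (simp add: frakD1_term_def D1_coeff_def D2_coeff_def B31_def B32_def B n
        add_divide_distrib diff_divide_distrib algebra_simps)
  ultimately show ?thesis
    using True by simp
qed

text \<open>The factor \<nu> in \<open>B31\<close> and \<open>B32\<close> makes the coefficients
  grow at most linearly, which the exponential decay of \<open>fhat\<close> absorbs.\<close>

lemma summable_frakD1_term:
  assumes cont: "continuous_on UNIV K1" "continuous_on UNIV K2"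
    and "\<xi> > 0" and fhat: "\<And>\<nu>. \<nu> \<ge> 1 \<Longrightarrow> \<bar>fhat \<nu>\<bar> \<le> \<Phi> * exp (- \<xi> * real \<nu>)"
  shows "summable (\<lambda>m. norm (frakD1_term p \<rho> \<Omega> K1 K2 fhat \<tau>0 (Suc m)))"
proof -
  define C where "C K = integral {0..2 * pi * real p} (\<lambda>\<tau>. \<bar>K \<tau>\<bar>)
      / (2 * pi * real p) / (\<rho>\<^sup>2 * \<Omega>\<^sup>2)" for K :: "real \<Rightarrow> real"
  have B: "\<bar>B_sin p \<rho> \<Omega> K \<nu>\<bar> \<le> C K" "\<bar>B_cos p \<rho> \<Omega> K \<nu>\<bar> \<le> C K"
    if K: "continuous_on UNIV K" for K \<nu>
  proof -
    let ?z = "oscillation K (real \<nu>) (2 * pi * real p) / (2 * pi * real p)"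
    have "norm ?z / (\<rho>\<^sup>2 * \<Omega>\<^sup>2) \<le> C K"
      unfolding C_def using norm_oscillation_le[OF K, of "real \<nu>" "2 * pi * real p"]
      by (intro divide_right_mono) (auto simp: norm_divide norm_mult intro!: divide_right_mono)
    moreover have "\<bar>Im ?z\<bar> / (\<rho>\<^sup>2 * \<Omega>\<^sup>2) \<le> norm ?z / (\<rho>\<^sup>2 * \<Omega>\<^sup>2)"
      "\<bar>Re ?z\<bar> / (\<rho>\<^sup>2 * \<Omega>\<^sup>2) \<le> norm ?z / (\<rho>\<^sup>2 * \<Omega>\<^sup>2)"
      by (intro divide_right_mono abs_Im_le_cmod abs_Re_le_cmod; simp)+
    ultimately show "\<bar>B_sin p \<rho> \<Omega> K \<nu>\<bar> \<le> C K" "\<bar>B_cos p \<rho> \<Omega> K \<nu>\<bar> \<le> C K"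
      unfolding B_sin_eq[OF K] B_cos_eq[OF K] abs_divide by simp_all
  qed
  \<comment> \<open>The last summand bounds \<open>B31\<close> and \<open>B32\<close> up to their
    factor \<nu>; the others are enlarged by \<nu> \<ge> 1.\<close>
  define M where "M = C K1 + C K2 + \<bar>\<rho> * \<Omega>\<bar> * C K2"
  have C_nonneg: "C K1 \<ge> 0" "C K2 \<ge> 0"
    using B(1)[OF cont(1)] B(1)[OF cont(2)] by (meson abs_ge_zero order_trans)+
  have D: "\<bar>D1_coeff p \<rho> \<Omega> K1 K2 \<nu>\<bar> \<le> M * real \<nu>" "\<bar>D2_coeff p \<rho> \<Omega> K1 K2 \<nu>\<bar> \<le> M * real \<nu>"
    if "\<nu> \<ge> 1" for \<nu>
  proof -
    have "real \<nu> \<ge> 1" using that by simp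
    then have grow: "C K1 \<le> C K1 * real \<nu>" "C K2 \<le> C K2 * real \<nu>"
      using C_nonneg by (simp_all add: mult_le_cancel_left1)
    have scaled: "\<bar>real \<nu> * \<rho> * \<Omega> * b\<bar> \<le> \<bar>\<rho> * \<Omega>\<bar> * C K2 * real \<nu>" if "\<bar>b\<bar> \<le> C K2" for b
      using mult_left_mono[OF that, of "\<bar>\<rho> * \<Omega>\<bar> * real \<nu>"] by (simp add: abs_mult algebra_simps)
    have sum: "\<bar>- (b1 + b2 + b3)\<bar> \<le> M * real \<nu>"
      if "\<bar>b1\<bar> \<le> C K1" "\<bar>b2\<bar> \<le> C K2" "\<bar>b3\<bar> \<le> \<bar>\<rho> * \<Omega>\<bar> * C K2 * real \<nu>" for b1 b2 b3
    proof -
      have "\<bar>- (b1 + b2 + b3)\<bar> \<le> \<bar>b1\<bar> + \<bar>b2\<bar> + \<bar>b3\<bar>"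
        by linarith
      also have "\<dots> \<le> C K1 * real \<nu> + C K2 * real \<nu> + \<bar>\<rho> * \<Omega>\<bar> * C K2 * real \<nu>"
        by (intro add_mono order_trans[OF that(1) grow(1)] order_trans[OF that(2) grow(2)] that(3))
      also have "\<dots> = M * real \<nu>"
        by (simp add: M_def distrib_right)
      finally show ?thesis .
    qed
    show "\<bar>D1_coeff p \<rho> \<Omega> K1 K2 \<nu>\<bar> \<le> M * real \<nu>"
      unfolding D1_coeff_def B31_def by (intro sum scaled B cont)
    have "\<bar>- real \<nu> * \<rho> * \<Omega> * B_sin p \<rho> \<Omega> K2 \<nu>\<bar> \<le> \<bar>\<rho> * \<Omega>\<bar> * C K2 * real \<nu>"
      using scaled[OF B(1)[OF cont(2)], of \<nu>] by simp
    then show "\<bar>D2_coeff p \<rho> \<Omega> K1 K2 \<nu>\<bar> \<le> M * real \<nu>"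
      unfolding D2_coeff_def B32_def by (intro sum B cont)
  qed
  have bound: "norm (frakD1_term p \<rho> \<Omega> K1 K2 fhat \<tau>0 (Suc m))
      \<le> 2 * M * \<Phi> * exp (- \<xi>) * (real (Suc m) * exp (- \<xi>) ^ m)" for m
  proof -
    let ?\<nu> = "Suc m"
    have "\<bar>D1_coeff p \<rho> \<Omega> K1 K2 ?\<nu> * cos (real ?\<nu> * \<tau>0)\<bar> \<le> (M * real ?\<nu>) * 1"
      "\<bar>D2_coeff p \<rho> \<Omega> K1 K2 ?\<nu> * sin (real ?\<nu> * \<tau>0)\<bar> \<le> (M * real ?\<nu>) * 1"
      unfolding abs_mult by (rule mult_mono; use D[of ?\<nu>] in simp)+
    then have "\<bar>D1_coeff p \<rho> \<Omega> K1 K2 ?\<nu> * cos (real ?\<nu> * \<tau>0)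
        + D2_coeff p \<rho> \<Omega> K1 K2 ?\<nu> * sin (real ?\<nu> * \<tau>0)\<bar> \<le> 2 * M * real ?\<nu>"
      by linarith
    moreover have "\<bar>fhat ?\<nu>\<bar> \<le> \<Phi> * exp (- \<xi> * real ?\<nu>)"
      by (rule fhat) simp
    ultimately have "norm (frakD1_term p \<rho> \<Omega> K1 K2 fhat \<tau>0 ?\<nu>)
        \<le> (\<Phi> * exp (- \<xi> * real ?\<nu>)) * (2 * M * real ?\<nu>)"
      unfolding frakD1_term_def real_norm_def abs_mult[of "fhat _"]
      by (intro mult_mono) (auto intro: order_trans[OF abs_ge_zero])
    \<comment> \<open>One factor exp (-\<xi>) is split off because \<nu> = m + 1; what remains is
      the differentiated geometric series.\<close>
    also have "exp (- \<xi> * real ?\<nu>) = exp (- \<xi>) * exp (- \<xi>) ^ m"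
      by (simp add: exp_of_nat_mult[symmetric] exp_add[symmetric] algebra_simps)
    finally show ?thesis
      by (simp add: algebra_simps)
  qed
  have "summable (\<lambda>m. real (Suc m) * exp (- \<xi>) ^ m)"
    using geometric_deriv_sums[of "exp (- \<xi>)"] \<open>\<xi> > 0\<close> by (auto simp: sums_iff)
  then have "summable (\<lambda>m. 2 * M * \<Phi> * exp (- \<xi>) * (real (Suc m) * exp (- \<xi>) ^ m))"
    by (rule summable_mult)
  then show ?thesis
    by (rule summable_comparison_test[rotated]) (use bound in auto)
qed

lemma frakD1_resonance_expansion:
  assumes cont: "continuous_on UNIV K1" "continuous_on UNIV K2"
    and per: "\<And>t. K1 (t + pi * \<rho>) = K1 t" "\<And>t. K2 (t + pi * \<rho>) = K2 t"
    and pq: "p > 0" "q > 0" "\<rho> = real p / real q" and "\<Omega> \<noteq> 0"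
    and "\<xi> > 0" and fhat: "\<And>\<nu>. \<nu> \<ge> 1 \<Longrightarrow> \<bar>fhat \<nu>\<bar> \<le> \<Phi> * exp (- \<xi> * real \<nu>)"
  shows "summable (\<lambda>m. frakD1_term p \<rho> \<Omega> K1 K2 fhat \<tau>0 (Suc m))" (is ?summable)
    and "resonant_term \<rho> \<Omega> K1 K2 fhat \<tau>0 summable_on even_resonances \<rho>" (is ?summable_on)
    and "complex_of_real (frakD1 p \<rho> \<Omega> A K1 K2 fhat \<tau>0) = - 1 / complex_of_real (A * \<rho>\<^sup>2 * \<Omega>\<^sup>2) *
       (\<Sum>\<^sub>\<infinity>\<nu>\<in>even_resonances \<rho>. resonant_term \<rho> \<Omega> K1 K2 fhat \<tau>0 \<nu>)" (is ?expansion)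
proof -
  define g where "g \<nu> = frakD1_term p \<rho> \<Omega> K1 K2 fhat \<tau>0 \<nu>" for \<nu>
  define r where "r \<nu> = resonant_term \<rho> \<Omega> K1 K2 fhat \<tau>0 \<nu>" for \<nu>
  define S where "S = (\<Sum>m. g (Suc m))"
  define d where "d = complex_of_real (\<rho>\<^sup>2 * \<Omega>\<^sup>2)"
  have "d \<noteq> 0"
    using pq \<open>\<Omega> \<noteq> 0\<close> by (simp add: d_def)
  have abs: "summable (\<lambda>m. norm (g (Suc m)))"
    unfolding g_def by (rule summable_frakD1_term[OF cont \<open>\<xi> > 0\<close> fhat])
  then show sum: ?summable
    unfolding g_def by (rule summable_norm_cancel)
  then have "(\<lambda>m. g (Suc m)) sums S"
    unfolding S_def g_def by (rule summable_sums)
  then have "(\<lambda>m. complex_of_real (g (Suc m))) sums complex_of_real S"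
    by (rule sums_of_real)
  then have "((\<lambda>m. complex_of_real (g (Suc m))) has_sum complex_of_real S) UNIV"
    using abs by (intro norm_summable_imp_has_sum) auto
  then have "((\<lambda>\<nu>. complex_of_real (g \<nu>)) has_sum complex_of_real S) (Suc ` UNIV)"
    by (subst has_sum_reindex) (auto simp: o_def)
  also have "?this \<longleftrightarrow> ((\<lambda>\<nu>. - 1 / d * r \<nu>) has_sum complex_of_real S) (even_resonances \<rho>)"
  proof (rule has_sum_cong_neutral)
    have term_eq: "complex_of_real (g \<nu>) = (if \<nu> \<in> even_resonances \<rho> then - 1 / d * r \<nu> else 0)"
      if "\<nu> \<ge> 1" for \<nu>
      using frakD1_term_eq_resonant_term[OF cont per pq that, of \<Omega> fhat \<tau>0]
      by (simp only: g_def r_def d_def)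
    have ge1: "\<nu> \<ge> 1" if "\<nu> \<in> even_resonances \<rho> \<or> \<nu> \<in> range Suc" for \<nu>
      using that by (auto simp: even_resonances_def)
    have in_range: "\<nu> \<in> range Suc" if "\<nu> \<in> even_resonances \<rho>" for \<nu>
      using ge1[of \<nu>] that by (cases \<nu>) auto
    show "complex_of_real (g \<nu>) = 0" if "\<nu> \<in> range Suc - even_resonances \<rho>" for \<nu>
      using term_eq[OF ge1] that by auto
    show "- 1 / d * r \<nu> = 0" if "\<nu> \<in> even_resonances \<rho> - range Suc" for \<nu>
      using in_range that by auto
    show "complex_of_real (g \<nu>) = - 1 / d * r \<nu>" if "\<nu> \<in> range Suc \<inter> even_resonances \<rho>" for \<nu>
      using term_eq[OF ge1] that by auto
  qed
  \<comment> \<open>Multiplication by -d cancels the factor -1 / d and isolates the sum of the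
    resonant terms.\<close>
  finally have "((\<lambda>\<nu>. - d * (- 1 / d * r \<nu>)) has_sum (- d * complex_of_real S)) (even_resonances \<rho>)"
    by (rule has_sum_cmult_right)
  then have *: "(r has_sum (- d * complex_of_real S)) (even_resonances \<rho>)"
    using \<open>d \<noteq> 0\<close> by simp
  then show ?summable_on
    unfolding r_def by (auto simp: summable_on_def)
  have "(\<Sum>\<^sub>\<infinity>\<nu>\<in>even_resonances \<rho>. r \<nu>) = - d * complex_of_real S"
    using * by (rule infsumI)
  moreover have "frakD1 p \<rho> \<Omega> A K1 K2 fhat \<tau>0 = 1 / A * S"
    by (simp add: frakD1_def S_def g_def)
  ultimately show ?expansion
    using \<open>d \<noteq> 0\<close> unfolding r_def by (simp add: d_def field_simps)
qed

subsection \<open>Symmetry of the kernels\<close>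

lemma F_int_has_derivative:
  assumes "continuous_on UNIV u0"
  shows "(F_int \<beta> \<rho> \<Omega> u0 has_real_derivative lienard_h \<beta> (u0 \<tau>) / (\<rho> * \<Omega>)) (at \<tau>)"
proof -
  \<comment> \<open>The interval [-R, R] contains both endpoints 0 and \<tau>, and has \<tau> in its
    interior, so the one-interval derivative is a full one.\<close>
  define R where "R = \<bar>\<tau>\<bar> + 1"
  have "((\<lambda>u. LBINT s=ereal 0..ereal u. lienard_h \<beta> (u0 s)) has_vector_derivative
      lienard_h \<beta> (u0 \<tau>)) (at \<tau> within {-R..R})"
    unfolding lienard_h_def
    by (rule interval_integral_FTC2)
      (auto simp: R_def intro!: continuous_intros continuous_on_subset[OF assms])
  moreover have "at \<tau> within {-R..R} = at \<tau>"
    by (rule at_within_Icc_at) (auto simp: R_def)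
  ultimately have "((\<lambda>u. LBINT s=ereal 0..ereal u. lienard_h \<beta> (u0 s)) has_real_derivative
      lienard_h \<beta> (u0 \<tau>)) (at \<tau>)"
    by (simp add: has_real_derivative_iff_has_vector_derivative)
  from DERIV_cmult[OF this, of "1 / (\<rho> * \<Omega>)"] show ?thesis
    by (simp add: F_int_def[abs_def])
qed

text \<open>\<open>lienard_h\<close> is even, so \<open>F_int\<close> gains the same amount over
  every half period. This amount is half the gain over 2\<pi>\<rho>, which is what the linear term
  in \<open>F_tilde\<close> subtracts.\<close>

lemma F_tilde_half_period:
  assumes cont: "continuous_on UNIV u0" and anti: "\<And>t. u0 (t + pi * \<rho>) = - u0 t" and "\<rho> \<noteq> 0"
  shows "F_tilde \<beta> \<rho> \<Omega> u0 (t + pi * \<rho>) = F_tilde \<beta> \<rho> \<Omega> u0 t"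
proof -
  let ?F = "F_int \<beta> \<rho> \<Omega> u0" and ?L = "pi * \<rho>"
  have "((\<lambda>t. ?F (t + ?L) - ?F t) has_real_derivative 0) (at t)" for t
  proof -
    have "((\<lambda>t. ?F (t + ?L)) has_real_derivative lienard_h \<beta> (u0 (t + ?L)) / (\<rho> * \<Omega>)) (at t)"
      using F_int_has_derivative[OF cont, of \<beta> \<rho> \<Omega> "t + ?L"] by (simp only: DERIV_shift)
    from DERIV_diff[OF this F_int_has_derivative[OF cont, of \<beta> \<rho> \<Omega> t]] show ?thesis
      by (simp add: anti lienard_h_def)
  qed
  then have "?F (t + ?L) - ?F t = ?F (0 + ?L) - ?F 0" for t
    by (rule DERIV_isconst_all[rule_format])
  moreover have "?F 0 = 0"
    by (simp add: F_int_def)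
  ultimately have step: "?F (t + ?L) = ?F t + ?F ?L" for t
    by (simp add: algebra_simps)
  have "?F (2 * pi * \<rho>) = 2 * ?F ?L"
    using step[of ?L] by (simp add: mult.assoc)
  then show ?thesis
    using \<open>\<rho> \<noteq> 0\<close> by (simp add: F_tilde_def F_mean_def step field_simps)
qed

lemma continuous_on_F_tilde:
  assumes "continuous_on UNIV u0"
  shows "continuous_on UNIV (F_tilde \<beta> \<rho> \<Omega> u0)"
proof -
  have "continuous_on UNIV (F_int \<beta> \<rho> \<Omega> u0)"
    by (intro continuous_at_imp_continuous_on ballI DERIV_isCont[OF F_int_has_derivative[OF assms]])
  then show ?thesis
    unfolding F_tilde_def[abs_def] by (intro continuous_intros)
qed

section \<open>The linearised equation along the limit cycle\<close>

lemma deriv_rescaled_G: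
  "deriv (\<lambda>u. rescaled_G \<alpha> \<beta> \<rho> \<Omega> u v) u
    = - (v * (6 * \<beta> * u)) / (\<rho> * \<Omega>) - (\<alpha> - \<beta> + 3 * \<beta> * u\<^sup>2) / (\<rho>\<^sup>2 * \<Omega>\<^sup>2)"
  "deriv (\<lambda>v. rescaled_G \<alpha> \<beta> \<rho> \<Omega> u v) v = - (lienard_h \<beta> u / (\<rho> * \<Omega>))"
proof -
  show "deriv (\<lambda>u. rescaled_G \<alpha> \<beta> \<rho> \<Omega> u v) u
    = - (v * (6 * \<beta> * u)) / (\<rho> * \<Omega>) - (\<alpha> - \<beta> + 3 * \<beta> * u\<^sup>2) / (\<rho>\<^sup>2 * \<Omega>\<^sup>2)"
    unfolding rescaled_G_def lienard_h_def lienard_k_def divide_inverse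
    by (rule DERIV_imp_deriv)
      (rule derivative_eq_intros refl | simp add: algebra_simps power2_eq_square)+
  show "deriv (\<lambda>v. rescaled_G \<alpha> \<beta> \<rho> \<Omega> u v) v = - (lienard_h \<beta> u / (\<rho> * \<Omega>))"
    unfolding rescaled_G_def divide_inverse
    by (rule DERIV_imp_deriv) (rule derivative_eq_intros refl | simp)+
qed

text \<open>Differentiating an autonomous equation along a solution shows that the velocity solves
  the linearisation. This supplies the first solution in the Floquet argument.\<close>

lemma velocity_solves_linearisation:
  assumes u: "\<And>\<tau>. (u0 has_real_derivative v0 \<tau>) (at \<tau>)"
    and v: "\<And>\<tau>. (v0 has_real_derivative rescaled_G \<alpha> \<beta> \<rho> \<Omega> (u0 \<tau>) (v0 \<tau>)) (at \<tau>)"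
  shows "((\<lambda>\<tau>. rescaled_G \<alpha> \<beta> \<rho> \<Omega> (u0 \<tau>) (v0 \<tau>)) has_real_derivative
      (deriv (\<lambda>u. rescaled_G \<alpha> \<beta> \<rho> \<Omega> u (v0 \<tau>)) (u0 \<tau>) * v0 \<tau>
       + deriv (\<lambda>v. rescaled_G \<alpha> \<beta> \<rho> \<Omega> (u0 \<tau>) v) (v0 \<tau>)
         * rescaled_G \<alpha> \<beta> \<rho> \<Omega> (u0 \<tau>) (v0 \<tau>))) (at \<tau>)"
proof -
  let ?V = "rescaled_G \<alpha> \<beta> \<rho> \<Omega> (u0 \<tau>) (v0 \<tau>)"
  have "((\<lambda>\<tau>. - (v0 \<tau> * lienard_h \<beta> (u0 \<tau>)) * inverse (\<rho> * \<Omega>)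
        - lienard_k \<alpha> \<beta> (u0 \<tau>) * inverse (\<rho>\<^sup>2 * \<Omega>\<^sup>2)) has_real_derivative
      (- (v0 \<tau> * (6 * \<beta> * u0 \<tau>)) * inverse (\<rho> * \<Omega>)
        - (\<alpha> - \<beta> + 3 * \<beta> * (u0 \<tau>)\<^sup>2) * inverse (\<rho>\<^sup>2 * \<Omega>\<^sup>2)) * v0 \<tau>
       + - (lienard_h \<beta> (u0 \<tau>) * inverse (\<rho> * \<Omega>)) * ?V) (at \<tau>)"
    unfolding lienard_h_def lienard_k_def
    by (rule derivative_eq_intros u v refl
        | simp add: algebra_simps power2_eq_square del: inverse_mult_distrib)+
  then show ?thesis
    unfolding deriv_rescaled_G unfolding divide_inverse
    by (simp add: rescaled_G_def divide_inverse)
qed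

section \<open>Half-period symmetry of both kernels and the resonance formula\<close>

theorem mainTheorem2:
  fixes \<alpha> \<beta> T0 \<Omega>0 \<rho> U0 \<Phi> \<xi> A c f0 :: real
    and p q :: nat
    and f :: "real \<Rightarrow> real" and fhat :: "nat \<Rightarrow> real"
    and x y u0 v0 w w' a b K1 K2 :: "real \<Rightarrow> real"
  assumes "\<alpha> > \<beta>" and "\<beta> > 1"
    and "\<forall>t. f (- t) = - f t"
    and "real_analytic f"
    and "\<forall>t. f (t + 2 * pi) = f t"
    and "\<forall>t. (\<lambda>m. fhat (Suc m) * sin (real (Suc m) * t)) sums f t"
    and "\<Phi> > 0" and "\<xi> > 0"
    and "\<forall>\<nu>\<ge>1. \<bar>fhat \<nu>\<bar> \<le> \<Phi> * exp (- \<xi> * real \<nu>)"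
    and "p > 0" and "q > 0" and "coprime p q" and "\<rho> = real p / real q"
    \<comment> \<open>the limit cycle, in the original and in the rescaled time\<close>
    and "lienard_limit_cycle \<alpha> \<beta> x y T0" and "\<Omega>0 = 2 * pi / T0"
    and "\<forall>\<tau>. (u0 has_real_derivative v0 \<tau>) (at \<tau>)"
    and "\<forall>\<tau>. (v0 has_real_derivative rescaled_G \<alpha> \<beta> \<rho> \<Omega>0 (u0 \<tau>) (v0 \<tau>)) (at \<tau>)"
    and "\<exists>s. \<forall>\<tau>. u0 \<tau> = x (s + \<tau> / (\<rho> * \<Omega>0))"
    and "v0 0 = 0" and "u0 0 = U0" and "U0 > 0"
    \<comment> \<open>the solution of the linearised equation and its decomposition\<close>
    and "\<forall>\<tau>. (w has_real_derivative w' \<tau>) (at \<tau>)"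
    and "\<forall>\<tau>. (w' has_real_derivative
               (deriv (\<lambda>u. rescaled_G \<alpha> \<beta> \<rho> \<Omega>0 u (v0 \<tau>)) (u0 \<tau>) * w \<tau> +
                deriv (\<lambda>v. rescaled_G \<alpha> \<beta> \<rho> \<Omega>0 (u0 \<tau>) v) (v0 \<tau>) * w' \<tau>)) (at \<tau>)"
    and "w 0 = 1" and "w' 0 = 0"
    and "f0 = F_mean \<beta> \<rho> \<Omega>0 u0"
    and "\<forall>\<tau>. w \<tau> = a \<tau> + exp (- f0 * \<tau>) * b \<tau>"
    and "\<forall>\<tau>. a (\<tau> + 2 * pi * \<rho>) = a \<tau>" and "\<forall>\<tau>. b (\<tau> + 2 * pi * \<rho>) = b \<tau>"
    and "\<forall>\<tau>. a \<tau> = c * v0 \<tau>"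
    and "A = A_coeff \<alpha> \<beta> \<rho> \<Omega>0 u0 v0 b"
    and "K1 = kernel1 \<beta> \<rho> \<Omega>0 u0 v0 b" and "K2 = kernel2 \<beta> \<rho> \<Omega>0 u0 b"
  shows "\<forall>\<tau>0::real.
     summable (\<lambda>m. frakD1_term p \<rho> \<Omega>0 K1 K2 fhat \<tau>0 (Suc m)) \<and>
     resonant_term \<rho> \<Omega>0 K1 K2 fhat \<tau>0 summable_on even_resonances \<rho> \<and>
     complex_of_real (frakD1 p \<rho> \<Omega>0 A K1 K2 fhat \<tau>0) =
       - 1 / complex_of_real (A * \<rho>\<^sup>2 * \<Omega>0\<^sup>2) *
       (\<Sum>\<^sub>\<infinity>\<nu>\<in>even_resonances \<rho>. resonant_term \<rho> \<Omega>0 K1 K2 fhat \<tau>0 \<nu>)"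
proof -
  note lc = assms(14) and \<Omega>0 = assms(15) and u = assms(16)[rule_format] and v = assms(17)[rule_format]
    and w = assms(22)[rule_format] and w' = assms(23)[rule_format]
  let ?L = "pi * \<rho>" and ?V = "\<lambda>\<tau>. rescaled_G \<alpha> \<beta> \<rho> \<Omega>0 (u0 \<tau>) (v0 \<tau>)"
  have "\<rho> > 0"
    using assms(10,11,13) by simp
  have "T0 > 0"
    using lc by (simp add: lienard_limit_cycle_def)
  then have "\<Omega>0 > 0" and half: "pi / \<Omega>0 = T0 / 2"
    by (simp_all add: \<Omega>0)
  have cont: "continuous_on UNIV u0" "continuous_on UNIV v0" "continuous_on UNIV w"
    by (auto intro!: continuous_at_imp_continuous_on intro: DERIV_isCont u v w)

  obtain s where s: "\<And>\<tau>. u0 \<tau> = x (s + \<tau> / (\<rho> * \<Omega>0))"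
    using assms(18) by blast
  have u_anti: "u0 (\<tau> + ?L) = - u0 \<tau>" for \<tau>
  proof -
    \<comment> \<open>The rescaled shift \<pi>\<rho> corresponds to \<pi> / \<Omega>0 = T0 / 2 in
      the original time.\<close>
    have "s + (\<tau> + ?L) / (\<rho> * \<Omega>0) = s + \<tau> / (\<rho> * \<Omega>0) + T0 / 2"
      using \<open>\<rho> > 0\<close> by (simp add: add_divide_distrib flip: half)
    then show ?thesis
      unfolding s by (simp only: lienard_limit_cycle_half_period[OF lc])
  qed
  have v_anti: "v0 (\<tau> + ?L) = - v0 \<tau>" for \<tau>
    using derivative_multiplier[of u0 v0 ?L "- 1", OF u] u_anti by simp

  define P where "P \<tau> = deriv (\<lambda>v. rescaled_G \<alpha> \<beta> \<rho> \<Omega>0 (u0 \<tau>) v) (v0 \<tau>)" for \<tau>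
  define Q where "Q \<tau> = deriv (\<lambda>u. rescaled_G \<alpha> \<beta> \<rho> \<Omega>0 u (v0 \<tau>)) (u0 \<tau>)" for \<tau>
  \<comment> \<open>Removing the periodic part c v0 from \<open>w\<close> leaves exp (- f0 \<tau>) b
    \<tau>, a solution with Floquet multiplier exp (-2\<pi>\<rho> f0) over a full period.\<close>
  define z where "z \<tau> = w \<tau> - c * v0 \<tau>" for \<tau>
  have z_b: "z \<tau> = exp (- f0 * \<tau>) * b \<tau>" for \<tau>
    using assms(27,30) by (simp add: z_def)
  have b_z: "b \<tau> = exp (f0 * \<tau>) * z \<tau>" for \<tau>
    by (simp add: z_b exp_minus)
  have z_anti: "z (\<tau> + ?L) = - exp (- f0 * ?L) * z \<tau>" for \<tau>
  proof (rule antiperiodic_second_solution[of v0 ?V Q P z "\<lambda>\<tau>. w' \<tau> - c * ?V \<tau>"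
        "F_int \<beta> \<rho> \<Omega>0 u0"])
    show V: "(?V has_real_derivative Q \<tau> * v0 \<tau> + P \<tau> * ?V \<tau>) (at \<tau>)" for \<tau>
      unfolding P_def Q_def by (rule velocity_solves_linearisation[OF u v])
    show "(z has_real_derivative w' \<tau> - c * ?V \<tau>) (at \<tau>)" for \<tau>
      unfolding z_def by (intro DERIV_diff DERIV_cmult w v)
    have "((\<lambda>\<tau>. w' \<tau> - c * ?V \<tau>) has_real_derivative
        (Q \<tau> * w \<tau> + P \<tau> * w' \<tau>) - c * (Q \<tau> * v0 \<tau> + P \<tau> * ?V \<tau>)) (at \<tau>)" for \<tau>
      using w'[of \<tau>] unfolding P_def[symmetric] Q_def[symmetric] by (intro DERIV_diff DERIV_cmult V)
    then show "((\<lambda>\<tau>. w' \<tau> - c * ?V \<tau>) has_real_derivative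
        Q \<tau> * z \<tau> + P \<tau> * (w' \<tau> - c * ?V \<tau>)) (at \<tau>)" for \<tau>
      by (simp add: z_def algebra_simps)
    show "(F_int \<beta> \<rho> \<Omega>0 u0 has_real_derivative - P \<tau>) (at \<tau>)" for \<tau>
      using F_int_has_derivative[OF cont(1)] by (simp add: P_def deriv_rescaled_G)
    \<comment> \<open>Both coefficients are invariant under (u, v) -> (-u, -v).\<close>
    show "P (\<tau> + ?L) = P \<tau>" "Q (\<tau> + ?L) = Q \<tau>" for \<tau>
      by (simp_all add: P_def Q_def deriv_rescaled_G u_anti v_anti lienard_h_def)
    show "z (\<tau> + 2 * ?L) = (exp (- f0 * ?L))\<^sup>2 * z \<tau>" for \<tau>
    proof -
      have "b (\<tau> + 2 * ?L) = b \<tau>"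
        using assms(29) by (simp add: mult.assoc)
      then show ?thesis
        unfolding z_b power2_eq_square
        by (simp add: algebra_simps flip: exp_add)
    qed
    \<comment> \<open>At \<tau> = 0 the velocity vanishes, so the acceleration is a nonzero multiple
      of \<open>lienard_k\<close> at U0.\<close>
    have "\<alpha> - \<beta> + \<beta> * U0\<^sup>2 > 0"
      using assms(1,2) by (intro add_pos_nonneg) auto
    then show "?V 0 \<noteq> 0"
      using \<open>\<rho> > 0\<close> \<open>\<Omega>0 > 0\<close> assms(19-21) by (simp add: rescaled_G_def lienard_k_def)
  qed (use u v v_anti assms(19,24) in \<open>auto simp: z_def\<close>)
  have b_anti: "b (\<tau> + ?L) = - b \<tau>" for \<tau>
    unfolding b_z z_anti by (simp add: exp_minus exp_add algebra_simps)
  have "continuous_on UNIV b"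
    unfolding b_z[abs_def] z_def by (intro continuous_intros cont)
  note cont = cont this continuous_on_F_tilde[OF cont(1)]
  note F_per = F_tilde_half_period[OF cont(1) u_anti]

  have "continuous_on UNIV K1" "continuous_on UNIV K2"
    unfolding assms(32,33) kernel1_def[abs_def] kernel2_def[abs_def]
    by (intro continuous_intros cont)+
  \<comment> \<open>The sign change of \<open>b\<close> cancels that of \<open>v0\<close> in
    \<open>K1\<close> and that of \<open>u0\<close> in \<open>K2\<close>; the other factors are
    invariant.\<close>
  moreover have "K1 (\<tau> + ?L) = K1 \<tau>" "K2 (\<tau> + ?L) = K2 \<tau>" for \<tau>
    using \<open>\<rho> > 0\<close> by (simp_all add: assms(32,33) kernel1_def kernel2_def F_per u_anti v_anti b_anti)
  ultimately show ?thesis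
    using frakD1_resonance_expansion[of K1 K2 \<rho> p q \<Omega>0 \<xi> fhat \<Phi>]
      assms(8-11,13) \<open>\<Omega>0 > 0\<close> by blast
qed

end
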